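(* Let $G$ be a connected graph of diameter $2$ and let $x$ be a vertex of $G$. If $G-x$ also has diameter $2$, then ${\rm gp}(G)-1\le {\rm gp}(G-x)\le {\rm gp}(G)$. Moreover, both bounds are sharp: there exist such graphs $G$ and vertices $x$ with ${\rm gp}(G-x)={\rm gp}(G)-1$, and there exist such graphs $G$ and vertices $x$ with ${\rm gp}(G-x)={\rm gp}(G)$.
   Context: All graphs are simple. A set $X\subseteq V(G)$ is a general position set of $G$ if no three distinct vertices of $X$ lie on a common shortest path of $G$; ${\rm gp}(G)$ is the maximum cardinality of a general position set of $G$. $G-x$ is the subgraph induced by $V(G)\setminus\{x\}$. *)

theory Defs
  imports "Graph_Theory.Graph_Theory"
begin

text \<open>
  Finite simple graphs are digraphs satisfying the locale predicate \<open>graph\<close> of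
  \<open>Graph_Theory.Digraph\<close> (finite, symmetric, without loops or parallel arcs): an edge is
  a pair of opposite arcs, so walks and their lengths are those of the undirected graph.
\<close>

text \<open>With unit weights, \<open>\<mu>\<close> is the least number of edges on a walk, and \<open>\<infinity>\<close>
  if there is none; hence a disconnected graph has infinite diameter.\<close>
definition gdist :: "('a,'b) pre_digraph \<Rightarrow> 'a \<Rightarrow> 'a \<Rightarrow> ereal" where
  "gdist G u v = wf_digraph.\<mu> G (\<lambda>_. 1) u v"

definition gdiameter :: "('a,'b) pre_digraph \<Rightarrow> ereal" where
  "gdiameter G = (SUP u\<in>verts G. SUP v\<in>verts G. gdist G u v)"

definition shortest_path :: "('a,'b) pre_digraph \<Rightarrow> 'a \<Rightarrow> 'b awalk \<Rightarrow> 'a \<Rightarrow> bool" where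
  "shortest_path G u p v \<longleftrightarrow>
     pre_digraph.apath G u p v \<and> ereal (real (length p)) = gdist G u v"

definition general_position_set :: "('a,'b) pre_digraph \<Rightarrow> 'a set \<Rightarrow> bool" where
  "general_position_set G X \<longleftrightarrow> X \<subseteq> verts G \<and>
     \<not> (\<exists>a\<in>X. \<exists>b\<in>X. \<exists>c\<in>X. a \<noteq> b \<and> a \<noteq> c \<and> b \<noteq> c \<and>
          (\<exists>u p v. shortest_path G u p v \<and> {a, b, c} \<subseteq> set (pre_digraph.awalk_verts G u p)))"

definition gp :: "('a,'b) pre_digraph \<Rightarrow> nat" where
  "gp G = Max {card X | X. general_position_set G X}"

definition remove_vertex :: "('a,'b) pre_digraph \<Rightarrow> 'a \<Rightarrow> ('a,'b) pre_digraph" where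
  "remove_vertex G x = G \<restriction> (verts G - {x})"

end

theory Submission
  imports Defs
begin

text \<open>
  When all distances are at most \<open>2\<close>, a shortest path through three distinct vertices is an
  induced path on exactly these vertices. Being in general position is therefore a condition on
  adjacency only, so the general position sets of \<open>G - x\<close> are those of \<open>G\<close> avoiding \<open>x\<close>; deleting
  \<open>x\<close> from a largest general position set of \<open>G\<close> costs at most one vertex. For sharpness, the
  complete bipartite graph with parts \<open>A\<close>, \<open>B\<close> has general position number
  \<open>max (card A) (card B)\<close>, and one removes a leaf of a claw, or a vertex of a 4-cycle.
\<close>

section \<open>Distances, shortest paths and general position in diameter two\<close>

lemma (in wf_digraph) gdist_eq_INF_length:
  "gdist G u v = (INF p \<in> {p. awalk u p v}. ereal (real (length p)))"
  unfolding gdist_def \<mu>_def awalk_cost_def by (simp add: sum_list_triv)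

lemma (in wf_digraph) gdist_le_length:
  assumes "awalk u p v"
  shows "gdist G u v \<le> ereal (real (length p))"
  using assms unfolding gdist_eq_INF_length by (auto intro: INF_lower)

text \<open>A walk of length 0 forces \<open>u = v\<close> and a walk of length 1 is an arc. An
  unreachable \<open>v\<close> is covered too, its distance being \<infinity>.\<close>

lemma (in wf_digraph) two_le_gdist:
  assumes "u \<noteq> v" "\<not> u \<rightarrow>\<^bsub>G\<^esub> v"
  shows "2 \<le> gdist G u v"
  unfolding gdist_eq_INF_length
proof (rule INF_greatest)
  fix p assume "p \<in> {p. awalk u p v}"
  then have p: "awalk u p v" by simp
  have "p \<noteq> []" using p assms by (auto simp: awalk_Nil_iff)
  then obtain e q where e: "p = e # q" by (cases p) auto
  have "q \<noteq> []"
    using p assms by (auto simp: e awalk_simps dest: in_arcs_imp_in_arcs_ends)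
  then have "2 \<le> length p" by (cases q) (auto simp: e)
  then have "2 \<le> real (length p)" by linarith
  then show "2 \<le> ereal (real (length p))" by simp
qed

lemma (in wf_digraph) gdist_le_two:
  assumes "u \<in> verts G" "u = v \<or> u \<rightarrow>\<^bsub>G\<^esub> v \<or> (\<exists>w. u \<rightarrow>\<^bsub>G\<^esub> w \<and> w \<rightarrow>\<^bsub>G\<^esub> v)"
  shows "gdist G u v \<le> 2"
proof -
  have "\<exists>p. awalk u p v \<and> length p \<le> 2"
    using assms(2)
  proof (elim disjE exE conjE)
    assume "u = v"
    then show ?thesis using assms(1) by (intro exI[of _ "[]"]) (simp add: awalk_Nil_iff)
  next
    assume "u \<rightarrow>\<^bsub>G\<^esub> v"
    then obtain e where "e \<in> arcs G" "tail G e = u" "head G e = v" ..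
    then show ?thesis by (intro exI[of _ "[e]"]) (auto simp: awalk_simps)
  next
    fix w assume "u \<rightarrow>\<^bsub>G\<^esub> w" "w \<rightarrow>\<^bsub>G\<^esub> v"
    then obtain e f where "e \<in> arcs G" "tail G e = u" "head G e = w"
      "f \<in> arcs G" "tail G f = w" "head G f = v" by (meson reachableE)
    then show ?thesis by (intro exI[of _ "[e, f]"]) (auto simp: awalk_simps)
  qed
  then obtain p where p: "awalk u p v" "length p \<le> 2" by blast
  have "ereal (real (length p)) \<le> 2" using p(2) by simp
  with gdist_le_length[OF p(1)] show ?thesis by (rule order_trans)
qed

lemma gdist_le_gdiameter:
  "u \<in> verts G \<Longrightarrow> v \<in> verts G \<Longrightarrow> gdist G u v \<le> gdiameter G"
  unfolding gdiameter_def by (meson SUP_upper2 order_refl)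

lemma (in wf_digraph) gdiameter_eq_twoI:
  assumes "\<And>u v. u \<in> verts G \<Longrightarrow> v \<in> verts G \<Longrightarrow>
      u = v \<or> u \<rightarrow>\<^bsub>G\<^esub> v \<or> (\<exists>w. u \<rightarrow>\<^bsub>G\<^esub> w \<and> w \<rightarrow>\<^bsub>G\<^esub> v)"
    and "u \<in> verts G" "v \<in> verts G" "u \<noteq> v" "\<not> u \<rightarrow>\<^bsub>G\<^esub> v"
  shows "gdiameter G = 2"
proof (rule antisym)
  show "gdiameter G \<le> 2"
    unfolding gdiameter_def using assms(1) by (intro SUP_least gdist_le_two)
  show "2 \<le> gdiameter G"
    using two_le_gdist[OF assms(4,5)] gdist_le_gdiameter[OF assms(2,3)] by (rule order_trans)
qed

text \<open>The two arcs bound the distance by 2 from above, the distinct non-adjacent ends from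
  below, so the path is shortest whatever the diameter is.\<close>

lemma (in wf_digraph) shortest_path_two_arcs:
  assumes "a \<rightarrow>\<^bsub>G\<^esub> b" "b \<rightarrow>\<^bsub>G\<^esub> c" "\<not> a \<rightarrow>\<^bsub>G\<^esub> c" "a \<noteq> b" "b \<noteq> c" "a \<noteq> c"
  shows "\<exists>p. shortest_path G a p c \<and> set (awalk_verts a p) = {a, b, c}"
proof -
  obtain e f where ef: "e \<in> arcs G" "tail G e = a" "head G e = b"
    "f \<in> arcs G" "tail G f = b" "head G f = c"
    using assms(1,2) by (meson reachableE)
  have path: "apath a [e, f] c"
    using ef assms by (auto simp: apath_def awalk_simps)
  have "gdist G a c \<le> 2"
    using ef assms by (intro gdist_le_two) auto
  with two_le_gdist[of a c] assms have "gdist G a c = 2" by (simp add: antisym)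
  with path ef show ?thesis
    unfolding shortest_path_def by (intro exI[of _ "[e, f]"]) auto
qed

text \<open>Three distinct vertices on \<open>p\<close> require at least two arcs, and the diameter
  allows at most two. An arc between the ends would be a shorter walk. The middle vertex gets a name
  of its own because \<open>a\<close>, \<open>b\<close>, \<open>c\<close> may occur on
  \<open>p\<close> in any order.\<close>

lemma (in wf_digraph) shortest_path_through_three:
  assumes "gdiameter G \<le> 2" "shortest_path G u p v"
    and "{a, b, c} \<subseteq> set (awalk_verts u p)" "a \<noteq> b" "a \<noteq> c" "b \<noteq> c"
  shows "\<exists>w. {a, b, c} = {u, w, v} \<and> u \<rightarrow>\<^bsub>G\<^esub> w \<and> w \<rightarrow>\<^bsub>G\<^esub> v \<and> u \<noteq> v \<and> \<not> u \<rightarrow>\<^bsub>G\<^esub> v"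
proof -
  have path: "apath u p v" and len: "ereal (real (length p)) = gdist G u v"
    using assms(2) by (auto simp: shortest_path_def)
  have walk: "awalk u p v" and dist: "distinct (awalk_verts u p)"
    using path by (auto simp: apath_def)
  have "gdist G u v \<le> 2"
    using gdist_le_gdiameter[of u G v] walk assms(1)
    by (meson awalk_hd_in_verts awalk_last_in_verts order_trans)
  then have "length p \<le> 2" unfolding len[symmetric] by simp
  moreover have "card {a, b, c} \<le> Suc (length p)"
    using card_mono[OF _ assms(3)] card_length[of "awalk_verts u p"]
    by (simp add: length_awalk_verts del: insert_subset)
  then have "2 \<le> length p" using assms(4-6) by simp
  ultimately have "length p = 2" by simp
  then obtain e f where p: "p = [e, f]" by (auto simp: numeral_2_eq_2 length_Suc_conv)
  let ?w = "head G e"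
  have ef: "e \<in> arcs G" "f \<in> arcs G" "tail G e = u" "tail G f = ?w" "head G f = v"
    using walk by (auto simp: p awalk_simps)
  have "{a, b, c} \<subseteq> {u, ?w, v}" using assms(3) ef by (simp add: p)
  \<comment> \<open>The left side has exactly three elements and the right side at most three, so
    inclusion is equality.\<close>
  then have eq: "{a, b, c} = {u, ?w, v}"
    using assms(4-6) by (intro card_seteq) (auto simp: card_insert_if)
  have "\<not> u \<rightarrow>\<^bsub>G\<^esub> v"
  proof
    assume "u \<rightarrow>\<^bsub>G\<^esub> v"
    then obtain g where "g \<in> arcs G" "tail G g = u" "head G g = v" ..
    then have "awalk u [g] v" by (auto simp: awalk_simps)
    from gdist_le_length[OF this] show False unfolding len[symmetric] by (simp add: p)
  qed
  moreover have "u \<rightarrow>\<^bsub>G\<^esub> ?w" "?w \<rightarrow>\<^bsub>G\<^esub> v" using ef in_arcs_imp_in_arcs_ends by metis+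
  moreover have "u \<noteq> v" using dist ef by (simp add: p)
  ultimately show ?thesis using eq by blast
qed

text \<open>Adjacent-or-equal is transitive on \<open>X\<close>; in an undirected graph this means
  that \<open>X\<close> induces a disjoint union of cliques. Only \<open>a \<noteq> c\<close> is
  demanded, since for \<open>a = b\<close> or \<open>b = c\<close> the conclusion is one of the
  premises.\<close>

definition induced_path_free :: "('a,'b) pre_digraph \<Rightarrow> 'a set \<Rightarrow> bool" where
  "induced_path_free G X \<longleftrightarrow>
     (\<forall>a\<in>X. \<forall>b\<in>X. \<forall>c\<in>X. a \<noteq> c \<and> a \<rightarrow>\<^bsub>G\<^esub> b \<and> b \<rightarrow>\<^bsub>G\<^esub> c \<longrightarrow> a \<rightarrow>\<^bsub>G\<^esub> c)"

lemma (in loopfree_digraph) general_position_set_diameter_two: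
  assumes "gdiameter G \<le> 2"
  shows "general_position_set G X \<longleftrightarrow> X \<subseteq> verts G \<and> induced_path_free G X"
proof (intro iffI conjI)
  assume X: "general_position_set G X"
  then show "X \<subseteq> verts G" by (simp add: general_position_set_def)
  show "induced_path_free G X"
    unfolding induced_path_free_def
  proof (intro ballI impI, rule ccontr)
    fix a b c
    assume abc: "a \<in> X" "b \<in> X" "c \<in> X" "a \<noteq> c \<and> a \<rightarrow>\<^bsub>G\<^esub> b \<and> b \<rightarrow>\<^bsub>G\<^esub> c" "\<not> a \<rightarrow>\<^bsub>G\<^esub> c"
    \<comment> \<open>Absence of loops supplies the distinctness that general position asks
      for.\<close>
    then have ne: "a \<noteq> b" "b \<noteq> c" using adj_not_same by blast+
    then obtain p where "shortest_path G a p c" "set (awalk_verts a p) = {a, b, c}"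
      using shortest_path_two_arcs abc by meson
    with X abc ne show False unfolding general_position_set_def by blast
  qed
next
  assume X: "X \<subseteq> verts G \<and> induced_path_free G X"
  show "general_position_set G X"
    unfolding general_position_set_def
  proof (intro conjI notI)
    show "X \<subseteq> verts G" using X ..
    assume "\<exists>a\<in>X. \<exists>b\<in>X. \<exists>c\<in>X. a \<noteq> b \<and> a \<noteq> c \<and> b \<noteq> c \<and>
      (\<exists>u p v. shortest_path G u p v \<and> {a, b, c} \<subseteq> set (awalk_verts u p))"
    then obtain a b c u p v where abc: "a \<in> X" "b \<in> X" "c \<in> X" "a \<noteq> b" "a \<noteq> c" "b \<noteq> c"
      and "shortest_path G u p v" "{a, b, c} \<subseteq> set (awalk_verts u p)"
      by (elim bexE exE conjE)
    then obtain w where w: "{a, b, c} = {u, w, v}"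
      "u \<rightarrow>\<^bsub>G\<^esub> w" "w \<rightarrow>\<^bsub>G\<^esub> v" "u \<noteq> v" "\<not> u \<rightarrow>\<^bsub>G\<^esub> v"
      using shortest_path_through_three[OF assms] by meson
    then have "u \<in> X" "w \<in> X" "v \<in> X" using abc(1-3) by auto
    with X w show False unfolding induced_path_free_def by blast
  qed
qed

section \<open>The general position number as an attained maximum\<close>

lemma general_position_set_empty: "general_position_set G {}"
  by (simp add: general_position_set_def)

lemma finite_general_position_cards:
  assumes "finite (verts G)"
  shows "finite {card X | X. general_position_set G X}"
proof (rule finite_subset)
  show "{card X | X. general_position_set G X} \<subseteq> card ` Pow (verts G)"
    unfolding general_position_set_def by blast
  show "finite (card ` Pow (verts G))" using assms by simp
qed

lemma card_le_gp:
  assumes "finite (verts G)" "general_position_set G X"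
  shows "card X \<le> gp G"
  unfolding gp_def using assms by (intro Max_ge finite_general_position_cards) auto

lemma ex_general_position_set_card_gp:
  assumes "finite (verts G)"
  shows "\<exists>X. general_position_set G X \<and> card X = gp G"
proof -
  \<comment> \<open>\<open>Max\<close> is attained on a finite nonempty set; the empty general
    position set provides a member.\<close>
  have "{card X | X. general_position_set G X} \<noteq> {}" using general_position_set_empty[of G] by blast
  from Max_in[OF finite_general_position_cards[OF assms] this]
  show ?thesis unfolding gp_def[symmetric] by auto
qed

section \<open>Deleting a vertex\<close>

lemma verts_remove_vertex [simp]: "verts (remove_vertex G x) = verts G - {x}"
  by (simp add: remove_vertex_def)

lemma dominates_remove_vertex:
  "u \<rightarrow>\<^bsub>remove_vertex G x\<^esub> v \<longleftrightarrow> u \<rightarrow>\<^bsub>G\<^esub> v \<and> {u, v} \<subseteq> verts G - {x}"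
  unfolding remove_vertex_def arcs_ends_conv by auto

lemma (in loopfree_digraph) loopfree_digraph_remove_vertex:
  "loopfree_digraph (remove_vertex G x)"
  unfolding remove_vertex_def by unfold_locales (auto simp: no_loops)

text \<open>Deleting \<open>x\<close> may change distances but not adjacency among the remaining
  vertices. With both diameters at most 2, the adjacency criterion applies in both graphs.\<close>

lemma (in loopfree_digraph) general_position_set_remove_vertex:
  assumes "gdiameter G \<le> 2" "gdiameter (remove_vertex G x) \<le> 2"
  shows "general_position_set (remove_vertex G x) X \<longleftrightarrow> general_position_set G X \<and> x \<notin> X"
proof -
  have "induced_path_free (remove_vertex G x) X \<longleftrightarrow> induced_path_free G X"
    if X: "X \<subseteq> verts G - {x}"
  proof -
    have "u \<rightarrow>\<^bsub>remove_vertex G x\<^esub> v \<longleftrightarrow> u \<rightarrow>\<^bsub>G\<^esub> v" if "u \<in> X" "v \<in> X" for u v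
      using that X by (auto simp: dominates_remove_vertex)
    then show ?thesis unfolding induced_path_free_def by simp
  qed
  moreover have "X \<subseteq> verts G - {x} \<longleftrightarrow> X \<subseteq> verts G \<and> x \<notin> X" by blast
  moreover note general_position_set_diameter_two[OF assms(1), of X]
    loopfree_digraph.general_position_set_diameter_two
      [OF loopfree_digraph_remove_vertex assms(2), of X, unfolded verts_remove_vertex]
  ultimately show ?thesis by blast
qed

lemma (in digraph) gp_remove_vertex_bounds:
  assumes "gdiameter G \<le> 2" "gdiameter (remove_vertex G x) \<le> 2"
  shows "gp G - 1 \<le> gp (remove_vertex G x)" "gp (remove_vertex G x) \<le> gp G"
proof -
  note gps = general_position_set_remove_vertex[OF assms]
  have fin: "finite (verts (remove_vertex G x))" by simp
  obtain X where X: "general_position_set G X" "card X = gp G"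
    using ex_general_position_set_card_gp finite_verts by blast
  \<comment> \<open>Freeness from induced paths passes to subsets.\<close>
  have "general_position_set G (X - {x})"
    using X(1) unfolding general_position_set_diameter_two[OF assms(1)] induced_path_free_def
    by blast
  then have "card (X - {x}) \<le> gp (remove_vertex G x)"
    by (intro card_le_gp fin) (simp add: gps)
  moreover have "card X - 1 \<le> card (X - {x})" by (simp add: card_Diff_singleton_if)
  ultimately show "gp G - 1 \<le> gp (remove_vertex G x)" using X(2) by simp
  obtain Y where "general_position_set (remove_vertex G x) Y" "card Y = gp (remove_vertex G x)"
    using ex_general_position_set_card_gp fin by blast
  then show "gp (remove_vertex G x) \<le> gp G"
    using card_le_gp[OF finite_verts, of Y] gps[of Y] by simp
qed

section \<open>Complete bipartite graphs\<close>

definition complete_bipartite :: "'a set \<Rightarrow> 'a set \<Rightarrow> ('a, 'a \<times> 'a) pre_digraph" where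
  "complete_bipartite A B =
     \<lparr>verts = A \<union> B, arcs = A \<times> B \<union> B \<times> A, tail = fst, head = snd\<rparr>"

lemma verts_complete_bipartite [simp]: "verts (complete_bipartite A B) = A \<union> B"
  by (simp add: complete_bipartite_def)

lemma arcs_ends_complete_bipartite [simp]:
  "arcs_ends (complete_bipartite A B) = A \<times> B \<union> B \<times> A"
  by (simp add: complete_bipartite_def arcs_ends_conv)

text \<open>Deletion stays within the family, so one computation of diameter and \<open>gp\<close>
  serves both an example and its vertex-deleted subgraph.\<close>

lemma remove_vertex_complete_bipartite:
  "remove_vertex (complete_bipartite A B) x = complete_bipartite (A - {x}) (B - {x})"
  unfolding remove_vertex_def complete_bipartite_def induce_subgraph_def by auto

text \<open>Arcs are ordered pairs of vertices, so none are parallel; both orientations are present,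
  and disjoint parts exclude loops.\<close>

lemma graph_complete_bipartite:
  assumes "finite A" "finite B" "A \<inter> B = {}"
  shows "graph (complete_bipartite A B)"
proof -
  have "symmetric (complete_bipartite A B)"
    unfolding symmetric_def by (auto simp: sym_def)
  then show ?thesis
    using assms by unfold_locales (auto simp: complete_bipartite_def arc_to_ends_def)
qed

lemma connected_complete_bipartite:
  assumes "A \<noteq> {}" "B \<noteq> {}"
  shows "connected (complete_bipartite A B)"
proof -
  let ?V = "A \<union> B" and ?R = "(A \<times> B \<union> B \<times> A)\<^sup>s"
  have step: "(u, v) \<in> rtrancl_on ?V ?R" if "(u, v) \<in> A \<times> B \<union> B \<times> A" for u v
    using that by (intro rtrancl_on_into_rtrancl_on[OF rtrancl_on_refl]) (auto simp: symcl_def)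
  have "(u, v) \<in> rtrancl_on ?V ?R" if "u \<in> ?V" "v \<in> ?V" for u v
  proof -
    \<comment> \<open>Vertices in opposite parts are adjacent; two in the same part, possibly equal,
      share a neighbour in the other, nonempty part.\<close>
    have "(u, v) \<in> A \<times> B \<union> B \<times> A \<or>
        (\<exists>w. (u, w) \<in> A \<times> B \<union> B \<times> A \<and> (w, v) \<in> A \<times> B \<union> B \<times> A)"
      using that assms by blast
    then show ?thesis using step rtrancl_on_trans by metis
  qed
  then show ?thesis using assms by (simp add: connected_conv)
qed

text \<open>Two vertices of \<open>B\<close> form the non-adjacent pair. The asymmetric hypotheses
  admit a singleton \<open>A\<close>, so stars are covered.\<close>

lemma gdiameter_complete_bipartite:
  assumes "finite A" "finite B" "A \<inter> B = {}" "A \<noteq> {}" "2 \<le> card B"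
  shows "gdiameter (complete_bipartite A B) = 2"
proof -
  interpret graph "complete_bipartite A B"
    using assms(1-3) by (rule graph_complete_bipartite)
  obtain T where "T \<subseteq> B" "card T = 2"
    using obtain_subset_with_card_n[OF assms(5)] by blast
  then obtain u v where uv: "u \<in> B" "v \<in> B" "u \<noteq> v" by (auto simp: card_2_iff)
  show ?thesis
  proof (rule gdiameter_eq_twoI)
    show "s = t \<or> s \<rightarrow>\<^bsub>complete_bipartite A B\<^esub> t \<or>
        (\<exists>w. s \<rightarrow>\<^bsub>complete_bipartite A B\<^esub> w \<and> w \<rightarrow>\<^bsub>complete_bipartite A B\<^esub> t)"
      if "s \<in> verts (complete_bipartite A B)" "t \<in> verts (complete_bipartite A B)" for s t
      using that uv(1) assms(4) by simp blast
  qed (use uv assms(3) in auto)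
qed

text \<open>Each part is free of arcs, hence in general position. A set meeting both parts cannot
  have a third vertex, since two vertices of one part and one of the other form an induced path; its
  size is thus at most 2, which \<open>card B\<close> dominates.\<close>

lemma gp_complete_bipartite:
  assumes "finite A" "finite B" "A \<inter> B = {}" "A \<noteq> {}" "2 \<le> card B"
  shows "gp (complete_bipartite A B) = max (card A) (card B)"
proof (rule antisym)
  let ?K = "complete_bipartite A B"
  interpret graph ?K
    using assms(1-3) by (rule graph_complete_bipartite)
  have gps: "general_position_set ?K X \<longleftrightarrow> X \<subseteq> A \<union> B \<and> induced_path_free ?K X" for X
    using general_position_set_diameter_two gdiameter_complete_bipartite[OF assms] by simp
  have "general_position_set ?K A" "general_position_set ?K B"
    using assms(3) by (auto simp: gps induced_path_free_def)
  then show "max (card A) (card B) \<le> gp ?K"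
    using card_le_gp finite_verts by (metis max.bounded_iff)
  obtain X where X: "general_position_set ?K X" "card X = gp ?K"
    using ex_general_position_set_card_gp finite_verts by blast
  have sub: "X \<subseteq> A \<union> B" and free: "induced_path_free ?K X" using X(1) gps by auto
  show "gp ?K \<le> max (card A) (card B)"
  proof (cases "X \<subseteq> A \<or> X \<subseteq> B")
    case True
    then show ?thesis using X(2) assms(1,2) by (metis card_mono max.coboundedI1 max.coboundedI2)
  next
    case False
    then obtain a b where ab: "a \<in> X" "a \<in> A" "b \<in> X" "b \<in> B" using sub by blast
    have "X \<subseteq> {a, b}"
    proof
      fix c assume c: "c \<in> X"
      show "c \<in> {a, b}"
      proof (rule ccontr)
        assume "c \<notin> {a, b}"
        moreover have "c \<in> A \<or> c \<in> B" using c sub by blast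
        ultimately show False
          using free[unfolded induced_path_free_def, rule_format, of a b c]
            free[unfolded induced_path_free_def, rule_format, of b a c] ab c assms(3) by auto
      qed
    qed
    then have "card X \<le> 2" using card_mono[of "{a, b}" X] by (auto simp: card_insert_if split: if_splits)
    then show ?thesis using X(2) assms(5) by simp
  qed
qed

section \<open>The two bounds and graphs attaining them\<close>

theorem theorem5p2:
  shows "(\<forall>(G :: ('a,'b) pre_digraph) x.
            graph G \<and> connected G \<and> gdiameter G = 2 \<and> x \<in> verts G
              \<and> gdiameter (remove_vertex G x) = 2 \<longrightarrow>
            int (gp G) - 1 \<le> int (gp (remove_vertex G x))
              \<and> gp (remove_vertex G x) \<le> gp G)
       \<and> (\<exists>(G :: (nat, nat \<times> nat) pre_digraph) x.
            graph G \<and> connected G \<and> gdiameter G = 2 \<and> x \<in> verts G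
              \<and> gdiameter (remove_vertex G x) = 2
              \<and> int (gp (remove_vertex G x)) = int (gp G) - 1)
       \<and> (\<exists>(G :: (nat, nat \<times> nat) pre_digraph) x.
            graph G \<and> connected G \<and> gdiameter G = 2 \<and> x \<in> verts G
              \<and> gdiameter (remove_vertex G x) = 2
              \<and> gp (remove_vertex G x) = gp G)"
proof (intro conjI)
  show "\<forall>(G :: ('a,'b) pre_digraph) x.
      graph G \<and> connected G \<and> gdiameter G = 2 \<and> x \<in> verts G
        \<and> gdiameter (remove_vertex G x) = 2 \<longrightarrow>
      int (gp G) - 1 \<le> int (gp (remove_vertex G x)) \<and> gp (remove_vertex G x) \<le> gp G"
  proof (intro allI impI)
    fix G :: "('a,'b) pre_digraph" and x
    assume G: "graph G \<and> connected G \<and> gdiameter G = 2 \<and> x \<in> verts G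
      \<and> gdiameter (remove_vertex G x) = 2"
    then interpret graph G by simp
    \<comment> \<open>Truncated and integer subtraction agree here: either bound says
      \<open>gp G \<le> gp (remove_vertex G x) + 1\<close>.\<close>
    show "int (gp G) - 1 \<le> int (gp (remove_vertex G x)) \<and> gp (remove_vertex G x) \<le> gp G"
      using gp_remove_vertex_bounds[of x] G by auto
  qed
next
  \<comment> \<open>A claw with centre 0. Its three leaves are the larger part; deleting leaf 3
    shrinks that part to two, yet leaves a non-adjacent pair, so the diameter stays 2.\<close>
  let ?G = "complete_bipartite {0 :: nat} {1, 2, 3}"
  have H: "remove_vertex ?G 3 = complete_bipartite {0} {1, 2}"
    unfolding remove_vertex_complete_bipartite by (rule arg_cong2) auto
  have "graph ?G" "connected ?G" "gdiameter ?G = 2" "gp ?G = 3"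
    by (simp_all add: graph_complete_bipartite connected_complete_bipartite
        gdiameter_complete_bipartite gp_complete_bipartite)
  moreover have "gdiameter (remove_vertex ?G 3) = 2" "gp (remove_vertex ?G 3) = 2"
    unfolding H by (simp_all add: gdiameter_complete_bipartite gp_complete_bipartite)
  ultimately show "\<exists>(G :: (nat, nat \<times> nat) pre_digraph) x.
      graph G \<and> connected G \<and> gdiameter G = 2 \<and> x \<in> verts G
        \<and> gdiameter (remove_vertex G x) = 2
        \<and> int (gp (remove_vertex G x)) = int (gp G) - 1"
    by (intro exI[of _ ?G] exI[of _ 3]) simp
next
  \<comment> \<open>A 4-cycle. Deleting 0 leaves the part \<open>{2, 3}\<close> intact, which keeps
    both the diameter and \<open>gp\<close> at 2.\<close>
  let ?G = "complete_bipartite {0 :: nat, 1} {2, 3}"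
  have H: "remove_vertex ?G 0 = complete_bipartite {1} {2, 3}"
    unfolding remove_vertex_complete_bipartite by (rule arg_cong2) auto
  have "graph ?G" "connected ?G" "gdiameter ?G = 2" "gp ?G = 2"
    by (simp_all add: graph_complete_bipartite connected_complete_bipartite
        gdiameter_complete_bipartite gp_complete_bipartite)
  moreover have "gdiameter (remove_vertex ?G 0) = 2" "gp (remove_vertex ?G 0) = 2"
    unfolding H by (simp_all add: gdiameter_complete_bipartite gp_complete_bipartite)
  ultimately show "\<exists>(G :: (nat, nat \<times> nat) pre_digraph) x.
      graph G \<and> connected G \<and> gdiameter G = 2 \<and> x \<in> verts G
        \<and> gdiameter (remove_vertex G x) = 2
        \<and> gp (remove_vertex G x) = gp G"
    by (intro exI[of _ ?G] exI[of _ 0]) simp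
qed

end
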